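(* Let $\mathbb{F}$ be a field and let $\alpha_1,\ldots,\alpha_n$ be $n$ pairwise different elements of $\mathbb{F}$. Let $f\in\mathbb{F}[x_1,\ldots,x_n]$ be a polynomial of degree $\binom{n}{2}$. For each permutation $\pi\in S_n$, let $c_\pi$ denote the coefficient of the monomial $\prod_{i=1}^n x_i^{\pi(i)-1}$ in $f$. If $$\sum_{\pi\in S_n}\operatorname{sgn}(\pi)\,c_\pi\neq 0,$$ then there exists a point $s\in X(\alpha_1,\ldots,\alpha_n)=\{(\alpha_{\pi(1)},\ldots,\alpha_{\pi(n)}) : \pi\in S_n\}$ such that $f(s)\neq 0$.
   Context: $S_n$ denotes the symmetric group on $\{1,\ldots,n\}$ and $\operatorname{sgn}(\pi)$ the sign of the permutation $\pi$. *)

theory Defs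
  imports
    "HOL-Library.Poly_Mapping"
    "HOL-Library.FuncSet"
    "HOL-Combinatorics.Permutations"
begin

text \<open>
  Polynomials in variables indexed by natural numbers: finitely supported maps from exponent
  vectors to coefficients. The convolution product of \<open>Poly_Mapping\<close> makes this the
  usual polynomial ring. A polynomial in $x_1,\ldots,x_n$ is one whose variables lie in
  \<open>{1..n}\<close>.
\<close>

type_synonym monom_exp = "nat \<Rightarrow>\<^sub>0 nat"
type_synonym 'a mpoly = "monom_exp \<Rightarrow>\<^sub>0 'a"

definition mpoly_coeff :: "'a::zero mpoly \<Rightarrow> monom_exp \<Rightarrow> 'a"
  where "mpoly_coeff f m = Poly_Mapping.lookup f m"

definition mpoly_vars :: "'a::zero mpoly \<Rightarrow> nat set"
  where "mpoly_vars f = (\<Union>m\<in>Poly_Mapping.keys f. Poly_Mapping.keys m)"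

definition monom_degree :: "monom_exp \<Rightarrow> nat"
  where "monom_degree m = (\<Sum>i\<in>Poly_Mapping.keys m. Poly_Mapping.lookup m i)"

text \<open>Total degree, with the convention that the zero polynomial has degree 0.\<close>

definition total_degree :: "'a::zero mpoly \<Rightarrow> nat"
  where "total_degree f = Max (insert 0 (monom_degree ` Poly_Mapping.keys f))"

definition mpoly_eval :: "'a::comm_semiring_1 mpoly \<Rightarrow> (nat \<Rightarrow> 'a) \<Rightarrow> 'a"
  where "mpoly_eval f s =
    (\<Sum>m\<in>Poly_Mapping.keys f. mpoly_coeff f m *
      (\<Prod>i\<in>Poly_Mapping.keys m. s i ^ Poly_Mapping.lookup m i))"

text \<open>
  The exponent vector of $\prod_{i=1}^n x_i^{\pi(i)-1}$. For a permutation of \<open>{1..n}\<close>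
  we have \<open>\<pi> i \<ge> 1\<close>, so the subtraction on \<^typ>\<open>nat\<close> does not truncate.
\<close>

definition perm_exp :: "nat \<Rightarrow> (nat \<Rightarrow> nat) \<Rightarrow> monom_exp"
  where "perm_exp n \<pi> = (\<Sum>i=1..n. Poly_Mapping.single i (\<pi> i - 1))"

lemma lookup_perm_exp:
  "Poly_Mapping.lookup (perm_exp n \<pi>) i = (if i \<in> {1..n} then \<pi> i - 1 else 0)"
  by (simp add: perm_exp_def lookup_sum lookup_single when_def)

text \<open>Points of $\mathbb{F}^n$ are functions on \<open>{1..n}\<close>, extended by \<^const>\<open>undefined\<close>.\<close>

definition perm_points :: "nat \<Rightarrow> (nat \<Rightarrow> 'a) \<Rightarrow> (nat \<Rightarrow> 'a) set"
  where "perm_points n \<alpha> = {(\<lambda>i\<in>{1..n}. \<alpha> (\<pi> i)) |\<pi>. \<pi> permutes {1..n}}"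

end

theory Submission
  imports Defs "Jordan_Normal_Form.Determinant"
begin

text \<open>
  Consider the alternating sum $\sum_\pi \mathrm{sgn}(\pi) f(\alpha_{\pi(1)},\ldots,\alpha_{\pi(n)})$.
  A monomial of $f$ contributes its coefficient times the alternant
  $\det(\alpha_i^{e_j})$, which vanishes if two exponents coincide. Pairwise distinct exponents
  with sum at most $\binom{n}{2}$ are a permutation of $0,\ldots,n-1$, and then the alternant is
  the Vandermonde determinant up to the sign of that permutation. So the alternating sum equals
  the Vandermonde determinant times $\sum_\pi \mathrm{sgn}(\pi) c_\pi$, which is nonzero.
\<close>

text \<open>The Leibniz expansion of a determinant, written over permutations of
  \<open>{1..n}\<close> so that it matches the alternating sum of evaluations term by term.\<close>

definition alternant :: "nat \<Rightarrow> (nat \<Rightarrow> 'a::comm_ring_1) \<Rightarrow> (nat \<Rightarrow> nat) \<Rightarrow> 'a" where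
  "alternant n \<alpha> e =
    (\<Sum>\<pi> | \<pi> permutes {1..n}. of_int (sign \<pi>) * (\<Prod>i\<in>{1..n}. \<alpha> (\<pi> i) ^ e i))"

lemma alternant_cong:
  assumes "\<And>i. i \<in> {1..n} \<Longrightarrow> e i = e' i"
  shows "alternant n \<alpha> e = alternant n \<alpha> e'"
  unfolding alternant_def using assms by simp

text \<open>Replacing the summation variable \<pi> by \<open>\<pi> \<circ> \<rho>\<close> multiplies
  each sign by \<open>sign \<rho>\<close> and only reorders the factors of each product.\<close>

lemma alternant_permute:
  assumes \<rho>: "\<rho> permutes {1..n}"
  shows "alternant n \<alpha> (e \<circ> \<rho>) = of_int (sign \<rho>) * alternant n \<alpha> e"
proof -
  have fin: "finite {1..n}" by simp
  have perm: "permutation p" if "p permutes {1..n}" for p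
    using that fin by (rule permutes_imp_permutation[rotated])
  have "alternant n \<alpha> (e \<circ> \<rho>) = (\<Sum>\<pi> | \<pi> permutes {1..n}.
      of_int (sign (\<pi> \<circ> \<rho>)) * (\<Prod>i\<in>{1..n}. \<alpha> ((\<pi> \<circ> \<rho>) i) ^ (e \<circ> \<rho>) i))"
    unfolding alternant_def by (rule sum_permutations_compose_right[OF \<rho>])
  also have "\<dots> = (\<Sum>\<pi> | \<pi> permutes {1..n}.
      of_int (sign \<rho>) * (of_int (sign \<pi>) * (\<Prod>i\<in>{1..n}. \<alpha> (\<pi> i) ^ e i)))"
  proof (rule sum.cong[OF refl])
    fix \<pi> assume "\<pi> \<in> {\<pi>. \<pi> permutes {1..n}}"
    then have "sign (\<pi> \<circ> \<rho>) = sign \<pi> * sign \<rho>"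
      using perm \<rho> by (simp add: sign_compose)
    moreover have "(\<Prod>i\<in>{1..n}. \<alpha> ((\<pi> \<circ> \<rho>) i) ^ (e \<circ> \<rho>) i) = (\<Prod>i\<in>{1..n}. \<alpha> (\<pi> i) ^ e i)"
      using prod.permute[OF \<rho>, of "\<lambda>i. \<alpha> (\<pi> i) ^ e i"] by (simp add: comp_def)
    ultimately show "of_int (sign (\<pi> \<circ> \<rho>)) * (\<Prod>i\<in>{1..n}. \<alpha> ((\<pi> \<circ> \<rho>) i) ^ (e \<circ> \<rho>) i) =
        of_int (sign \<rho>) * (of_int (sign \<pi>) * (\<Prod>i\<in>{1..n}. \<alpha> (\<pi> i) ^ e i))"
      by (simp add: mult_ac)
  qed
  finally show ?thesis
    by (simp add: alternant_def sum_distrib_left)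
qed

text \<open>Matrix indices start at 0, so permutations of \<open>{0..<n}\<close> are carried to
  \<open>{1..n}\<close> by conjugation with \<open>Suc\<close>, which preserves signs. Exponents
  label rows and points label columns.\<close>

lemma alternant_eq_det:
  "alternant n \<alpha> e = det (mat n n (\<lambda>(i, j). \<alpha> (Suc j) ^ e (Suc i)))"
proof -
  let ?A = "mat n n (\<lambda>(i, j). \<alpha> (Suc j) ^ e (Suc i))"
  let ?T = "map_permutation {0..<n} Suc" and ?T' = "map_permutation {1..n} (\<lambda>i. i - 1)"
  have bij: "bij_betw Suc {0..<n} {1..n}"
    by (simp add: bij_betw_def image_Suc_atLeastLessThan atLeastLessThanSuc_atLeastAtMost)
  have bij': "bij_betw (\<lambda>i. i - 1) {1..n} {0..<n}"
    by (rule bij_betw_byWitness[where f' = Suc]) auto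
  have "det ?A = (\<Sum>p | p permutes {0..<n}. of_int (sign p) * (\<Prod>i = 0..<n. ?A $$ (i, p i)))"
    by (rule det_def') simp
  also have "\<dots> = alternant n \<alpha> e"
    unfolding alternant_def
  proof (rule sum.reindex_bij_witness[where i = ?T' and j = ?T])
    fix p assume p: "p \<in> {p. p permutes {0..<n}}"
    then show "?T' (?T p) = p" "?T p \<in> {p. p permutes {1..n}}"
      using map_permutation_compose_inv[OF bij] map_permutation_permutes[OF bij] by auto
    have "sign (?T p) = sign p"
      using p by (intro sign_map_permutation) auto
    moreover have "(\<Prod>i\<in>{1..n}. \<alpha> (?T p i) ^ e i) = (\<Prod>i = 0..<n. ?A $$ (i, p i))"
      unfolding prod.reindex_bij_betw[OF bij, symmetric]
    proof (rule prod.cong[OF refl])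
      fix i assume i: "i \<in> {0..<n}"
      then have "p i < n"
        using p permutes_in_image[of p "{0..<n}" i] by auto
      then show "\<alpha> (?T p (Suc i)) ^ e (Suc i) = ?A $$ (i, p i)"
        using i by (simp add: map_permutation_apply)
    qed
    ultimately show "of_int (sign (?T p)) * (\<Prod>i\<in>{1..n}. \<alpha> (?T p i) ^ e i) =
        of_int (sign p) * (\<Prod>i = 0..<n. ?A $$ (i, p i))"
      by simp
  next
    fix p assume "p \<in> {p. p permutes {1..n}}"
    then show "?T (?T' p) = p" "?T' p \<in> {p. p permutes {0..<n}}"
      using map_permutation_compose_inv[OF bij'] map_permutation_permutes[OF bij'] by auto
  qed
  finally show ?thesis by simp
qed

text \<open>A repeated exponent makes two rows of the matrix equal.\<close>

lemma alternant_eq_0: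
  assumes "\<not> inj_on e {1..n}"
  shows "alternant n \<alpha> e = 0"
proof -
  obtain i j where ij: "i \<in> {1..n}" "j \<in> {1..n}" "i \<noteq> j" "e i = e j"
    using assms by (auto simp: inj_on_def)
  let ?A = "mat n n (\<lambda>(i, j). \<alpha> (Suc j) ^ e (Suc i))"
  have "det ?A = 0"
  proof (rule det_identical_rows)
    show "?A \<in> carrier_mat n n" by simp
    show "i - 1 \<noteq> j - 1" "i - 1 < n" "j - 1 < n"
      using ij by auto
    then show "row ?A (i - 1) = row ?A (j - 1)"
      using ij by (intro eq_vecI) auto
  qed
  then show ?thesis by (simp add: alternant_eq_det)
qed

text \<open>The product formula is avoided: if the determinant were 0, a kernel vector would supply
  the coefficients of a nonzero polynomial of degree below \<open>n\<close> with \<open>n\<close>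
  distinct roots.\<close>

lemma vandermonde_nonzero:
  fixes \<alpha> :: "nat \<Rightarrow> 'a::field"
  assumes inj: "inj_on \<alpha> {1..n}"
  shows "alternant n \<alpha> (\<lambda>i. i - 1) \<noteq> 0"
proof
  let ?A = "mat n n (\<lambda>(i, j). \<alpha> (Suc j) ^ i)"
  assume "alternant n \<alpha> (\<lambda>i. i - 1) = 0"
  \<comment> \<open>After transposing, row \<open>i\<close> lists the powers of
    \<open>\<alpha> (Suc i)\<close>, so its product with \<open>v\<close> is the value there of the
    polynomial with coefficients \<open>v\<close>.\<close>
  then have "det ?A\<^sup>T = 0"
    by (simp add: alternant_eq_det det_transpose[of _ n])
  then obtain v where v: "v \<in> carrier_vec n" "v \<noteq> 0\<^sub>v n" and Av: "?A\<^sup>T *\<^sub>v v = 0\<^sub>v n"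
    using det_0_iff_vec_prod_zero_field[of "?A\<^sup>T" n] by auto
  define p where "p = (\<Sum>j<n. monom (v $ j) j)"
  have coeff: "coeff p j = (if j < n then v $ j else 0)" for j
    by (auto simp: p_def coeff_sum if_distrib cong: if_cong)
  have "p \<noteq> 0"
  proof
    assume "p = 0"
    then have "v = 0\<^sub>v n"
      using v(1) coeff by (intro eq_vecI) (auto, metis)
    with v(2) show False by simp
  qed
  have root: "poly p (\<alpha> (Suc i)) = 0" if "i < n" for i
  proof -
    have "poly p (\<alpha> (Suc i)) = (?A\<^sup>T *\<^sub>v v) $ i"
      using that v(1)
      by (auto simp: p_def poly_sum poly_monom scalar_prod_def mult.commute atLeast0LessThan)
    then show ?thesis using Av that by simp
  qed
  \<comment> \<open>A nonzero vector forces positive dimension; the strict bound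
    \<open>degree p < n\<close> could not hold for \<open>n = 0\<close>.\<close>
  have "n > 0"
    using v by (cases n) auto
  have "\<alpha> ` {1..n} \<subseteq> {x. poly p x = 0}"
  proof safe
    fix i assume "i \<in> {1..n}"
    then show "poly p (\<alpha> i) = 0" using root[of "i - 1"] by auto
  qed
  then have "card (\<alpha> ` {1..n}) \<le> card {x. poly p x = 0}"
    using \<open>p \<noteq> 0\<close> by (intro card_mono poly_roots_finite)
  also have "\<dots> \<le> degree p"
    using \<open>p \<noteq> 0\<close> by (rule card_poly_roots_bound)
  also have "degree p < n"
    using \<open>n > 0\<close> coeff by (intro degree_lessI) auto
  finally show False
    using inj by (simp add: card_image)
qed

text \<open>Among sets of \<open>n\<close> naturals, \<open>{..<n}\<close> has the least sum, and it
  alone attains it. The induction removes the maximum, which is at least the number of remaining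
  elements.\<close>

lemma lessThan_if_sum_le_choose:
  fixes S :: "nat set"
  assumes "finite S" "card S = n" "\<Sum>S \<le> n choose 2"
  shows "S = {..<n}"
  using assms
proof (induction n arbitrary: S)
  case 0
  then show ?case by simp
next
  case (Suc n)
  define M where "M = Max S"
  have "S \<noteq> {}" using Suc.prems by auto
  then have M: "M \<in> S" and S_le: "S \<subseteq> {..M}"
    using Suc.prems unfolding M_def by auto
  have "Suc n \<le> card {..M}"
    using card_mono[OF _ S_le] Suc.prems by simp
  then have "n \<le> M" by simp
  have sum: "\<Sum>S = M + \<Sum>(S - {M})"
    using Suc.prems M by (simp add: sum.remove)
  have choose: "Suc n choose 2 = n + (n choose 2)"
    by (simp add: numeral_2_eq_2)
  \<comment> \<open>Since \<open>n \<le> M\<close>, Pascal's rule leaves at most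
    \<open>n choose 2\<close> for the sum of the other elements.\<close>
  have "S - {M} = {..<n}"
    using Suc.prems M sum choose \<open>n \<le> M\<close> by (intro Suc.IH) auto
  moreover have "\<Sum>{..<n} = n choose 2"
    by (induction n) (simp_all add: numeral_2_eq_2)
  \<comment> \<open>The other elements already use up \<open>n choose 2\<close>, so at most
    \<open>n\<close> remains for \<open>M\<close>.\<close>
  ultimately have "M = n"
    using sum choose Suc.prems \<open>n \<le> M\<close> by simp
  then show ?case
    using \<open>S - {M} = {..<n}\<close> M by (auto simp: lessThan_Suc)
qed

text \<open>The degree bound forces the distinct exponents to fill \<open>{..<n}\<close>; raising
  each by one yields the permutation.\<close>

lemma exponent_eq_perm_exp:
  fixes m :: monom_exp
  assumes keys: "Poly_Mapping.keys m \<subseteq> {1..n}"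
    and deg: "monom_degree m \<le> n choose 2"
    and inj: "inj_on (Poly_Mapping.lookup m) {1..n}"
  obtains \<rho> where "\<rho> permutes {1..n}" "m = perm_exp n \<rho>"
proof -
  let ?e = "Poly_Mapping.lookup m"
  have "monom_degree m = (\<Sum>i\<in>{1..n}. ?e i)"
    unfolding monom_degree_def using keys
    by (intro sum.mono_neutral_left) (auto simp: in_keys_iff)
  also have "\<dots> = \<Sum>(?e ` {1..n})"
    using inj by (simp add: sum.reindex)
  finally have image: "?e ` {1..n} = {..<n}"
    using deg inj by (intro lessThan_if_sum_le_choose) (auto simp: card_image)
  \<comment> \<open>\<open>Suc\<close> undoes the shift in \<open>perm_exp\<close>; the identity
    outside \<open>{1..n}\<close> is what \<open>permutes\<close> demands.\<close>
  define \<rho> where "\<rho> i = (if i \<in> {1..n} then Suc (?e i) else i)" for i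
  have "bij_betw (Suc \<circ> ?e) {1..n} {1..n}"
    using inj unfolding bij_betw_def image_comp[symmetric] image
    by (simp add: comp_inj_on image_Suc_lessThan)
  then have "bij_betw \<rho> {1..n} {1..n}"
    by (rule bij_betw_cong[THEN iffD1, rotated]) (simp add: \<rho>_def)
  then have "\<rho> permutes {1..n}"
    by (rule bij_imp_permutes) (auto simp: \<rho>_def)
  moreover have "m = perm_exp n \<rho>"
    by (rule poly_mapping_eqI) (use keys in \<open>auto simp: lookup_perm_exp \<rho>_def in_keys_iff\<close>)
  ultimately show ?thesis by (rule that)
qed

text \<open>This lets a sum over exponent vectors be reindexed by permutations. Values in
  \<open>{1..n}\<close> are positive, so subtracting one loses nothing.\<close>

lemma inj_on_perm_exp: "inj_on (perm_exp n) {\<pi>. \<pi> permutes {1..n}}"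
proof (rule inj_onI, rule ext)
  fix \<pi> \<rho> i
  assume "\<pi> \<in> {\<pi>. \<pi> permutes {1..n}}" "\<rho> \<in> {\<pi>. \<pi> permutes {1..n}}"
    and eq: "perm_exp n \<pi> = perm_exp n \<rho>"
  then have perms: "\<pi> permutes {1..n}" "\<rho> permutes {1..n}" by simp_all
  show "\<pi> i = \<rho> i"
  proof (cases "i \<in> {1..n}")
    case True
    then have "\<pi> i - 1 = \<rho> i - 1"
      using arg_cong[OF eq, of "\<lambda>m. Poly_Mapping.lookup m i"] by (simp add: lookup_perm_exp)
    moreover have "\<pi> i \<in> {1..n}" "\<rho> i \<in> {1..n}"
      using True perms permutes_in_image by metis+
    ultimately show ?thesis by (simp add: eq_diff_iff)
  next
    case False
    then show ?thesis using perms by (simp add: permutes_not_in)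
  qed
qed

text \<open>On \<open>{1..n}\<close> the exponents of \<open>perm_exp n \<pi>\<close> are those of
  the Vandermonde case composed with \<pi>.\<close>

lemma alternant_perm_exp:
  assumes "\<pi> permutes {1..n}"
  shows "alternant n \<alpha> (Poly_Mapping.lookup (perm_exp n \<pi>)) =
    of_int (sign \<pi>) * alternant n \<alpha> (\<lambda>i. i - 1)"
  unfolding alternant_permute[OF assms, symmetric]
  by (rule alternant_cong) (simp add: lookup_perm_exp)

lemma alternating_sum_mpoly_eval:
  fixes f :: "'a::comm_ring_1 mpoly"
  assumes vars: "mpoly_vars f \<subseteq> {1..n}"
  shows "(\<Sum>\<pi> | \<pi> permutes {1..n}. of_int (sign \<pi>) * mpoly_eval f (\<lambda>i\<in>{1..n}. \<alpha> (\<pi> i))) =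
    (\<Sum>m\<in>Poly_Mapping.keys f. mpoly_coeff f m * alternant n \<alpha> (Poly_Mapping.lookup m))"
proof -
  have eval: "mpoly_eval f (\<lambda>i\<in>{1..n}. \<alpha> (\<pi> i)) =
      (\<Sum>m\<in>Poly_Mapping.keys f.
        mpoly_coeff f m * (\<Prod>i\<in>{1..n}. \<alpha> (\<pi> i) ^ Poly_Mapping.lookup m i))" for \<pi>
    unfolding mpoly_eval_def
  proof (intro sum.cong[OF refl] arg_cong2[where f = "(*)"] refl)
    fix m assume "m \<in> Poly_Mapping.keys f"
    then have "Poly_Mapping.keys m \<subseteq> {1..n}"
      using vars by (auto simp: mpoly_vars_def)
    then show "(\<Prod>i\<in>Poly_Mapping.keys m. (\<lambda>i\<in>{1..n}. \<alpha> (\<pi> i)) i ^ Poly_Mapping.lookup m i) =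
        (\<Prod>i\<in>{1..n}. \<alpha> (\<pi> i) ^ Poly_Mapping.lookup m i)"
      \<comment> \<open>Variables absent from \<open>m\<close> have exponent 0 and contribute
        factors 1.\<close>
      by (intro prod.mono_neutral_cong_left) (auto simp: in_keys_iff subset_iff)
  qed
  show ?thesis
    unfolding eval alternant_def sum_distrib_left
    by (subst sum.swap) (simp add: mult_ac)
qed

theorem theorem7:
  fixes n :: nat
    and \<alpha> :: "nat \<Rightarrow> 'a::field"
    and f :: "'a mpoly"
  assumes "inj_on \<alpha> {1..n}"
    and "mpoly_vars f \<subseteq> {1..n}"
    and "total_degree f = n choose 2"
    and "(\<Sum>\<pi> | \<pi> permutes {1..n}. of_int (sign \<pi>) * mpoly_coeff f (perm_exp n \<pi>)) \<noteq> 0"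
  shows "\<exists>s\<in>perm_points n \<alpha>. mpoly_eval f s \<noteq> 0"
proof (rule ccontr)
  assume "\<not> ?thesis"
  then have zero: "mpoly_eval f (\<lambda>i\<in>{1..n}. \<alpha> (\<pi> i)) = 0" if "\<pi> permutes {1..n}" for \<pi>
    using that unfolding perm_points_def by blast
  let ?A = "\<lambda>m. alternant n \<alpha> (Poly_Mapping.lookup m)"
  let ?V = "alternant n \<alpha> (\<lambda>i. i - 1)"
  let ?P = "perm_exp n ` {\<pi>. \<pi> permutes {1..n}}"
  let ?K = "Poly_Mapping.keys f"
  have finP: "finite ?P" by (simp add: finite_permutations)
  \<comment> \<open>With distinct exponents, the degree bound would put \<open>m\<close> into
    \<open>?P\<close>.\<close>
  have A_0: "?A m = 0" if m: "m \<in> ?K" "m \<notin> ?P" for m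
  proof (rule alternant_eq_0, rule notI)
    assume inj: "inj_on (Poly_Mapping.lookup m) {1..n}"
    have "Poly_Mapping.keys m \<subseteq> {1..n}"
      using m assms(2) by (auto simp: mpoly_vars_def)
    moreover have "monom_degree m \<le> n choose 2"
      unfolding assms(3)[symmetric] total_degree_def using m by (intro Max_ge) auto
    ultimately show False
      using inj m(2) by (metis exponent_eq_perm_exp imageI mem_Collect_eq)
  qed
  have "0 = (\<Sum>\<pi> | \<pi> permutes {1..n}. of_int (sign \<pi>) * mpoly_eval f (\<lambda>i\<in>{1..n}. \<alpha> (\<pi> i)))"
    using zero by simp
  also have "\<dots> = (\<Sum>m\<in>?K. mpoly_coeff f m * ?A m)"
    by (rule alternating_sum_mpoly_eval[OF assms(2)])
  \<comment> \<open>Passing from \<open>?K\<close> to \<open>?P\<close> goes through the union: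
    vectors added from \<open>?P\<close> have coefficient 0, and those then dropped from
    \<open>?K\<close> have alternant 0.\<close>
  also have "\<dots> = (\<Sum>m\<in>?K \<union> ?P. mpoly_coeff f m * ?A m)"
    using finP by (intro sum.mono_neutral_left) (auto simp: mpoly_coeff_def in_keys_iff)
  also have "\<dots> = (\<Sum>m\<in>?P. mpoly_coeff f m * ?A m)"
    using finP A_0 by (intro sum.mono_neutral_right) auto
  also have "\<dots> = (\<Sum>\<pi> | \<pi> permutes {1..n}. mpoly_coeff f (perm_exp n \<pi>) * ?A (perm_exp n \<pi>))"
    unfolding sum.reindex[OF inj_on_perm_exp] comp_def ..
  also have "\<dots> = (\<Sum>\<pi> | \<pi> permutes {1..n}.
      of_int (sign \<pi>) * mpoly_coeff f (perm_exp n \<pi>)) * ?V"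
    unfolding sum_distrib_right
    by (rule sum.cong) (simp_all add: alternant_perm_exp mult_ac)
  finally show False
    using assms(4) vandermonde_nonzero[OF assms(1)] by simp
qed

end
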